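(* For every integer $n>0$ the triple $(P_{2n-1}^*,\,P_{2n+1},\,h_{n-1}^* )$ is the reduced polynomial presentation (in $\Gamma_MI$) of the Markov triple $(3\psi_{2n-1},\,3\psi_{2n+1},\,6)$.
   Context: The odd Pell numbers are $\psi_1=1$, $\psi_3=5$, $\psi_{2n+3}=6\psi_{2n+1}-\psi_{2n-1}$. The odd $*$-Pell polynomials $P_{2n+1}\in\mathbb Z[s_1,s_2,s_3]$, $n\ge0$, are defined by $P_1=s_2$, $P_3=s_1^2s_2-s_1s_3-s_2^2$, and $P_{2n+3}=h_nP_{2n+1}-s_3^2P_{2n-1}$ for $n\ge1$, where $h_n=s_2^2-s_1s_3$ if $n$ is odd and $h_n=s_1^2-s_2$ if $n$ is even. A Markov triple is a triple $(a,b,c)$ of positive integers with $a^2+b^2+c^2-abc=0$. Let $A=\mathbb Z[s_1,s_2,s_3^{\pm1}]$ with the ring involution $f^*(s_1,s_2,s_3)=f\left(\frac{s_2}{s_3},\frac{s_1}{s_3},\frac1{s_3}\right)$. The $*$-Markov equation for $(a,b,c)\in A^3$ is $aa^*+bb^*+cc^*-abc=\frac{3s_1s_2-s_1^3}{s_3}$. Its initial solution is $I=(s_1,\frac{s_1}{s_3},s_1)$. The evaluation map $\mathrm{Ev}:A^3\to\mathbb Z^3$ evaluates each coordinate at $s_1=3,s_2=3,s_3=1$. The $*$-Markov group $\Gamma_M$ is the group of transformations of $A^3$ generated by: $\lambda_{i,j}:(a,b,c)\mapsto((-1)^ia,(-1)^{i+j}b,(-1)^jc)$, $i,j\in\mathbb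 Z/2$; $\sigma_1:(a,b,c)\mapsto(b,a,c)$ and $\sigma_2:(a,b,c)\mapsto(a,c,b)$; $\tau_1:(a,b,c)\mapsto(-a^*,c^*,b^*-ac)$ and $\tau_2:(a,b,c)\mapsto(b^*,a^*-bc,-c^* )$; $\mu_{i,j}:(a,b,c)\mapsto(s_3^ia,s_3^{-i-j}b,s_3^jc)$, $i,j\in\mathbb Z$. $\Gamma_MI$ is the orbit of $I$. A solution of the $*$-Markov equation written in the form $(f_1^*,f_2,f_3^* )$ is a reduced polynomial solution if each of $f_1,f_2,f_3$ is a nonconstant polynomial in $s_1,s_2,s_3$ not divisible by $s_3$. For a Markov triple $(a,b,c)$ with $0<a<b$, $0<c<b$, $6\le b$, "the reduced polynomial presentation" of $(a,b,c)$ is the unique reduced polynomial solution in $\Gamma_MI$ whose image under $\mathrm{Ev}$ is $(a,b,c)$. *)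

theory Defs
  imports
    "HOL-Library.Poly_Mapping"
    "HOL-Library.Product_Plus"
    "HOL-Algebra.Bij"
    "HOL-Algebra.Generated_Groups"
begin

(* The Laurent ring A = Z[s1, s2, s3, 1/s3] as the monoid ring of N x N x Z:
   the exponent (i, j, k) stands for the monomial s1^i s2^j s3^k. *)
type_synonym laurent = "(nat \<times> nat \<times> int) \<Rightarrow>\<^sub>0 int"

type_synonym triple = "laurent \<times> laurent \<times> laurent"

definition s1 :: laurent where "s1 = Poly_Mapping.single (1, 0, 0) 1"

definition s2 :: laurent where "s2 = Poly_Mapping.single (0, 1, 0) 1"

definition s3_pow :: "int \<Rightarrow> laurent" where
  "s3_pow k = Poly_Mapping.single (0, 0, k) 1"

definition s3 :: laurent where "s3 = s3_pow 1"

definition s3_inv :: laurent where "s3_inv = s3_pow (- 1)"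

(* Substitution s1 := x, s2 := y, s3 := z in a commutative ring; the argument w
   has to be the inverse of z and replaces 1/s3. *)
definition monom_subst :: "'a::comm_ring_1 \<Rightarrow> 'a \<Rightarrow> 'a \<Rightarrow> 'a \<Rightarrow> nat \<times> nat \<times> int \<Rightarrow> 'a" where
  "monom_subst x y z w = (\<lambda>(i, j, k).
     x ^ i * y ^ j * (if 0 \<le> k then z ^ nat k else w ^ nat (- k)))"

definition laurent_subst :: "'a::comm_ring_1 \<Rightarrow> 'a \<Rightarrow> 'a \<Rightarrow> 'a \<Rightarrow> laurent \<Rightarrow> 'a" where
  "laurent_subst x y z w f =
     (\<Sum>m\<in>Poly_Mapping.keys f. of_int (Poly_Mapping.lookup f m) * monom_subst x y z w m)"

definition star :: "laurent \<Rightarrow> laurent" where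
  "star = laurent_subst (s2 * s3_inv) (s1 * s3_inv) s3_inv s3"

definition ev :: "laurent \<Rightarrow> int" where
  "ev = laurent_subst 3 3 1 1"

definition Ev :: "triple \<Rightarrow> int \<times> int \<times> int" where
  "Ev = (\<lambda>(a, b, c). (ev a, ev b, ev c))"

(* The subring Z[s1, s2, s3] of A. *)
definition polys :: "laurent set" where
  "polys = {f. \<forall>(i, j, k)\<in>Poly_Mapping.keys f. 0 \<le> k}"

fun odd_pell :: "nat \<Rightarrow> int" where  (* odd_pell n is psi_(2n+1) *)
  "odd_pell 0 = 1"
| "odd_pell (Suc 0) = 5"
| "odd_pell (Suc (Suc n)) = 6 * odd_pell (Suc n) - odd_pell n"

definition h :: "nat \<Rightarrow> laurent" where
  "h n = (if odd n then s2 ^ 2 - s1 * s3 else s1 ^ 2 - s2)"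

fun star_pell :: "nat \<Rightarrow> laurent" where  (* star_pell n is P_(2n+1) *)
  "star_pell 0 = s2"
| "star_pell (Suc 0) = s1 ^ 2 * s2 - s1 * s3 - s2 ^ 2"
| "star_pell (Suc (Suc n)) = h (Suc n) * star_pell (Suc n) - s3 ^ 2 * star_pell n"

definition markov_triple :: "int \<times> int \<times> int \<Rightarrow> bool" where
  "markov_triple = (\<lambda>(a, b, c).
     0 < a \<and> 0 < b \<and> 0 < c \<and> a ^ 2 + b ^ 2 + c ^ 2 - a * b * c = 0)"

definition star_markov_solution :: "triple \<Rightarrow> bool" where
  "star_markov_solution = (\<lambda>(a, b, c).
     a * star a + b * star b + c * star c - a * b * c = (3 * s1 * s2 - s1 ^ 3) * s3_inv)"

definition initial_solution :: triple where
  "initial_solution = (s1, s1 * s3_inv, s1)"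

definition lambda_map :: "nat \<Rightarrow> nat \<Rightarrow> triple \<Rightarrow> triple" where
  "lambda_map i j = (\<lambda>(a, b, c). ((- 1) ^ i * a, (- 1) ^ (i + j) * b, (- 1) ^ j * c))"

definition sigma1 :: "triple \<Rightarrow> triple" where
  "sigma1 = (\<lambda>(a, b, c). (b, a, c))"

definition sigma2 :: "triple \<Rightarrow> triple" where
  "sigma2 = (\<lambda>(a, b, c). (a, c, b))"

definition tau1 :: "triple \<Rightarrow> triple" where
  "tau1 = (\<lambda>(a, b, c). (- star a, star c, star b - a * c))"

definition tau2 :: "triple \<Rightarrow> triple" where
  "tau2 = (\<lambda>(a, b, c). (star b, star a - b * c, - star c))"

definition mu_map :: "int \<Rightarrow> int \<Rightarrow> triple \<Rightarrow> triple" where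
  "mu_map i j = (\<lambda>(a, b, c). (s3_pow i * a, s3_pow (- i - j) * b, s3_pow j * c))"

definition star_markov_generators :: "(triple \<Rightarrow> triple) set" where
  "star_markov_generators =
     {lambda_map i j | i j. i \<in> {0, 1} \<and> j \<in> {0, 1}} \<union>
     {sigma1, sigma2, tau1, tau2} \<union>
     {mu_map i j | i j. True}"

definition star_markov_group :: "(triple \<Rightarrow> triple) set" where
  "star_markov_group = generate (BijGroup UNIV) star_markov_generators"

definition star_markov_orbit :: "triple set" where
  "star_markov_orbit = {g initial_solution | g. g \<in> star_markov_group}"

(* Since s3 is a unit of A, divisibility by s3 is taken in Z[s1, s2, s3]. *)
definition reduced_poly :: "laurent \<Rightarrow> bool" where
  "reduced_poly f \<longleftrightarrow>
     f \<in> polys \<and> (\<nexists>c::int. f = of_int c) \<and> (\<nexists>g. g \<in> polys \<and> f = s3 * g)"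

definition reduced_polynomial_solution :: "triple \<Rightarrow> bool" where
  "reduced_polynomial_solution X \<longleftrightarrow> star_markov_solution X \<and>
     (\<exists>f1 f2 f3. X = (star f1, f2, star f3) \<and>
        reduced_poly f1 \<and> reduced_poly f2 \<and> reduced_poly f3)"

(* The last conjunct says both existence and uniqueness: X is a reduced polynomial
   solution in the orbit lying over t, and it is the only one. *)
definition reduced_polynomial_presentation :: "triple \<Rightarrow> int \<times> int \<times> int \<Rightarrow> bool" where
  "reduced_polynomial_presentation X t \<longleftrightarrow>
     markov_triple t \<and>
     (case t of (a, b, c) \<Rightarrow> 0 < a \<and> a < b \<and> 0 < c \<and> c < b \<and> 6 \<le> b) \<and>
     {Y \<in> star_markov_orbit. reduced_polynomial_solution Y \<and> Ev Y = t} = {X}"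

end

theory Submission
  imports Defs
begin

text \<open>
  Apart from signs, permutations and rescalings by powers of \<open>s3\<close>, the group has one move, the
  \<open>*\<close>-Vieta move \<open>(a, b, c) \<mapsto> (a*, ac - b*, c*)\<close>. On evaluations it is the classical Vieta move
  \<open>(a, b, c) \<mapsto> (a, ac - b, c)\<close>, which organises the positive Markov triples as a tree rooted at
  \<open>(3, 3, 3)\<close>.

  Existence. The generators preserve the \<open>*\<close>-Markov form, and one Vieta move followed by a
  sign change and a rescaling by powers of \<open>s3\<close> takes each Pell triple to the next one, because
  \<open>h (n + 1)\<close> and \<open>star (h n)\<close> differ by the factor \<open>s3\<^sup>2\<close> (lemmas \<open>h_Suc\<close> and \<open>pell_step\<close>).
  The first triple arises by the same step from a neighbour of the initial solution
  (\<open>pell_triple_0\<close>). The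
  polynomials are reduced because at \<open>s3 = 0\<close> their recursion becomes multiplicative, so that
  both the vanishing at \<open>s1 = s2 = 0\<close> and the nonvanishing at \<open>s1 = 2, s2 = 1\<close> propagate.

  Uniqueness. The point is that the fibres of \<open>Ev\<close> on the positive part of the orbit are single
  orbits of the rescalings \<open>mu_map i j\<close> (\<open>markov_tree_fibre\<close>). For this, the positive part is
  generated inductively from the initial solution by permutations, rescalings, and only those
  Vieta moves that increase the evaluation. Such a tree is nevertheless closed under all Vieta
  moves (\<open>markov_tree_vieta\<close>): at a newly grown triple, one move leads back to the parent and the
  other two increase again. Hence the orbit is the tree up to signs. If two
  elements of the tree lie over the same triple, the move that undoes the last step of the first
  one can be applied to both, and they still lie over a common triple. Induction thus reduces the
  claim to the root, over which there are only rescalings of the initial solution, since no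
  growing move ends there. Finally a
  rescaling that relates two reduced solutions is trivial, as neither of them has a factor \<open>s3\<close>.
\<close>

section \<open>Substitution homomorphisms\<close>

lemma laurent_subst_superset:
  assumes "finite A" "Poly_Mapping.keys f \<subseteq> A"
  shows "laurent_subst x y z w f =
           (\<Sum>m\<in>A. of_int (Poly_Mapping.lookup f m) * monom_subst x y z w m)"
  unfolding laurent_subst_def
  by (rule sum.mono_neutral_left) (use assms in \<open>auto simp: in_keys_iff\<close>)

lemma laurent_subst_0 [simp]: "laurent_subst x y z w 0 = 0"
  by (simp add: laurent_subst_def)

lemma laurent_subst_diff:
  "laurent_subst x y z w (f - g) = laurent_subst x y z w f - laurent_subst x y z w g"
proof -
  let ?A = "Poly_Mapping.keys f \<union> Poly_Mapping.keys g"
  have "Poly_Mapping.keys (f - g) \<subseteq> ?A"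
    by (auto simp: in_keys_iff lookup_minus)
  then show ?thesis
    by (simp add: laurent_subst_superset[of ?A] lookup_minus sum_subtractf left_diff_distrib)
qed

lemma laurent_subst_uminus: "laurent_subst x y z w (- f) = - laurent_subst x y z w f"
  using laurent_subst_diff[of x y z w 0 f] by simp

lemma laurent_subst_add:
  "laurent_subst x y z w (f + g) = laurent_subst x y z w f + laurent_subst x y z w g"
  using laurent_subst_diff[of x y z w f "- g"] by (simp add: laurent_subst_uminus)

lemma laurent_subst_single:
  "laurent_subst x y z w (Poly_Mapping.single m c) = of_int c * monom_subst x y z w m"
  by (subst laurent_subst_superset[of "{m}"]) auto

lemma laurent_subst_of_int: "laurent_subst x y z w (of_int c) = of_int c"
  unfolding single_of_int[symmetric] laurent_subst_single
  by (simp add: monom_subst_def zero_prod_def)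

text \<open>
  Multiplicativity is reduced to exponents in a set \<open>S\<close>, because it is used in two situations:
  for all exponents when \<open>w\<close> is inverse to \<open>z\<close>, and for exponents with a nonnegative power of
  \<open>s3\<close> when \<open>z\<close> is \<open>0\<close>. Both sides are additive in \<open>f\<close> and in \<open>g\<close>, so monomials suffice.
\<close>

lemma laurent_subst_mult_on:
  assumes monom: "\<And>m m'. m \<in> S \<Longrightarrow> m' \<in> S \<Longrightarrow>
      monom_subst x y z w (m + m') = monom_subst x y z w m * monom_subst x y z w m'"
    and "Poly_Mapping.keys f \<subseteq> S" "Poly_Mapping.keys g \<subseteq> S"
  shows "laurent_subst x y z w (f * g) = laurent_subst x y z w f * laurent_subst x y z w g"
  using assms(2)
proof (induction f rule: frag_induction)
  case (one m)
  show ?case using assms(3)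
  proof (induction g rule: frag_induction)
    case (one m')
    then show ?case
      using monom \<open>m \<in> S\<close> by (simp add: mult_single laurent_subst_single)
  qed (auto simp: laurent_subst_diff right_diff_distrib)
qed (auto simp: laurent_subst_diff left_diff_distrib)

text \<open>
  The case distinction in \<^const>\<open>monom_subst\<close> encodes an integer power of a unit; writing the
  exponent as a difference of naturals removes the case distinction and makes the power law
  immediate.
\<close>

lemma unit_power_diff:
  assumes "z * w = (1::'a::comm_ring_1)"
  shows "(if 0 \<le> int a - int b then z ^ nat (int a - int b) else w ^ nat (- (int a - int b)))
           = z ^ a * w ^ b"
proof (cases "b \<le> a")
  case True
  then obtain d where d: "a = b + d" using le_Suc_ex by blast
  have "z ^ a * w ^ b = z ^ d * (z * w) ^ b"
    by (simp add: d power_add power_mult_distrib mult_ac)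
  then show ?thesis by (simp add: d assms)
next
  case False
  then obtain d where d: "b = a + d" using le_Suc_ex nat_le_linear by blast
  have "z ^ a * w ^ b = w ^ d * (z * w) ^ a"
    by (simp add: d power_add power_mult_distrib mult_ac)
  with False show ?thesis by (auto simp: d assms)
qed

lemma monom_subst_add:
  assumes "z * w = 1"
  shows "monom_subst x y z w (m + m') = monom_subst x y z w m * monom_subst x y z w m'"
proof -
  obtain i j k i' j' k' where m: "m = (i, j, k)" "m' = (i', j', k')"
    by (metis prod_cases3)
  obtain a b where k: "k = int a - int b" using int_diff_cases by blast
  obtain a' b' where k': "k' = int a' - int b'" using int_diff_cases by blast
  have kk: "k + k' = int (a + a') - int (b + b')" by (simp add: k k')
  show ?thesis
    unfolding m monom_subst_def plus_prod_def fst_conv snd_conv case_prod_conv kk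
      unit_power_diff[OF assms] unfolding k k' unit_power_diff[OF assms]
    by (simp add: power_add mult_ac)
qed

lemma laurent_subst_mult:
  assumes "z * w = 1"
  shows "laurent_subst x y z w (f * g) = laurent_subst x y z w f * laurent_subst x y z w g"
  by (rule laurent_subst_mult_on[of UNIV]) (auto simp: monom_subst_add[OF assms])

lemma s3_pow_add: "s3_pow (k + l) = s3_pow k * s3_pow l"
  by (simp add: s3_pow_def mult_single)

lemma s3_pow_0 [simp]: "s3_pow 0 = 1"
  by (simp add: s3_pow_def flip: zero_prod_def)

lemma s3_pow_cancel [simp]: "s3_pow k * s3_pow (- k) = 1" "s3_pow (- k) * s3_pow k = 1"
  by (simp_all flip: s3_pow_add)

lemma s3_pow_nat: "s3_pow (int n) = s3 ^ n"
  by (induction n) (simp_all add: s3_pow_add s3_def)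

lemma s3_inv_pow_nat: "s3_pow (- int n) = s3_inv ^ n"
proof (induction n)
  case (Suc n)
  have "- int (Suc n) = - 1 + - int n" by simp
  with Suc show ?case by (simp only: s3_pow_add power_Suc s3_inv_def)
qed simp

lemma s3_inverse [simp]: "s3 * s3_inv = 1" "s3_inv * s3 = 1"
  by (simp_all add: s3_def s3_inv_def)

lemma s3_cancel: "s3 * (s3_inv * x) = x" "s3_inv * (s3 * x) = x"
  by (simp_all flip: mult.assoc)

lemma laurent_monomial:
  "Poly_Mapping.single (i, j, k) (1::int) = s1 ^ i * s2 ^ j * s3_pow k"
proof -
  have 1: "s1 ^ i = Poly_Mapping.single (i, 0, 0) 1"
    by (induction i) (simp_all add: s1_def mult_single flip: zero_prod_def)
  have 2: "s2 ^ j = Poly_Mapping.single (0, j, 0) 1"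
    by (induction j) (simp_all add: s2_def mult_single flip: zero_prod_def)
  show ?thesis
    by (simp add: 1 2 s3_pow_def mult_single)
qed

lemma star_0 [simp]: "star 0 = 0"
  and star_1 [simp]: "star 1 = 1"
  and star_diff [simp]: "star (f - g) = star f - star g"
  and star_uminus [simp]: "star (- f) = - star f"
  and star_mult [simp]: "star (f * g) = star f * star g"
  using laurent_subst_of_int[of _ _ _ _ 1]
  by (simp_all add: star_def laurent_subst_diff laurent_subst_uminus laurent_subst_mult)

lemma star_power [simp]: "star (f ^ n) = star f ^ n"
  by (induction n) simp_all

lemma star_s1 [simp]: "star s1 = s2 * s3_inv"
  and star_s2 [simp]: "star s2 = s1 * s3_inv"
  by (simp_all add: star_def s1_def s2_def laurent_subst_single monom_subst_def)

lemma star_s3_pow [simp]: "star (s3_pow k) = s3_pow (- k)"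
proof (cases "0 \<le> k")
  case True
  then have "s3_inv ^ nat k = s3_pow (- k)"
    using s3_inv_pow_nat[of "nat k"] by simp
  with True show ?thesis
    by (simp add: star_def s3_pow_def laurent_subst_single monom_subst_def)
next
  case False
  then have "s3 ^ nat (- k) = s3_pow (- k)"
    using s3_pow_nat[of "nat (- k)"] by simp
  with False show ?thesis
    by (simp add: star_def s3_pow_def laurent_subst_single monom_subst_def)
qed

lemma star_s3 [simp]: "star s3 = s3_inv" and star_s3_inv [simp]: "star s3_inv = s3"
  by (simp_all add: s3_def s3_inv_def)

lemma star_star [simp]: "star (star f) = f"
proof -
  have "Poly_Mapping.keys f \<subseteq> UNIV" by simp
  then show ?thesis
  proof (induction f rule: frag_induction)
    case (one m)
    have "s1 * s3_inv * s3 = s1" "s2 * s3_inv * s3 = s2"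
      by (simp_all add: mult.assoc)
    then show ?case
      by (cases m) (simp add: laurent_monomial)
  qed auto
qed

lemma star_eq_iff: "star f = star g \<longleftrightarrow> f = g"
  by (metis star_star)

lemma ev_diff [simp]: "ev (f - g) = ev f - ev g"
  and ev_uminus [simp]: "ev (- f) = - ev f"
  and ev_mult [simp]: "ev (f * g) = ev f * ev g"
  and ev_0 [simp]: "ev 0 = 0"
  and ev_1 [simp]: "ev 1 = 1"
  using laurent_subst_of_int[of 3 3 1 1 1]
  by (simp_all add: ev_def laurent_subst_diff laurent_subst_uminus laurent_subst_mult)

lemma ev_power [simp]: "ev (f ^ n) = ev f ^ n"
  by (induction n) simp_all

lemma ev_s [simp]: "ev s1 = 3" "ev s2 = 3" "ev (s3_pow k) = 1" "ev s3 = 1" "ev s3_inv = 1"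
  by (simp_all add: ev_def s1_def s2_def s3_def s3_inv_def s3_pow_def laurent_subst_single
      monom_subst_def)

lemma ev_star [simp]: "ev (star f) = ev f"
proof -
  have "Poly_Mapping.keys f \<subseteq> UNIV" by simp
  then show ?thesis
    by (induction f rule: frag_induction) (auto simp: laurent_monomial)
qed

section \<open>Reduced polynomials\<close>

lemma polys_iff: "f \<in> polys \<longleftrightarrow> Poly_Mapping.keys f \<subseteq> {(i, j, k). 0 \<le> k}"
  by (auto simp: polys_def)

lemma polys_diff: "f \<in> polys \<Longrightarrow> g \<in> polys \<Longrightarrow> f - g \<in> polys"
  using keys_diff[of f g] unfolding polys_iff by blast

lemma polys_mult: "f \<in> polys \<Longrightarrow> g \<in> polys \<Longrightarrow> f * g \<in> polys"
  using keys_mult[of f g] unfolding polys_def by fastforce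

lemma polys_1: "1 \<in> polys"
  by (auto simp: polys_def zero_prod_def)

lemma polys_power: "f \<in> polys \<Longrightarrow> f ^ n \<in> polys"
  by (induction n) (auto simp: polys_1 polys_mult)

lemma polys_s: "s1 \<in> polys" "s2 \<in> polys" "s3 \<in> polys"
  by (auto simp: polys_def s1_def s2_def s3_def s3_pow_def)

lemmas polys_intros = polys_diff polys_mult polys_power polys_s

text \<open>
  The value of a polynomial at \<open>s3 = 0\<close>. As \<open>s3\<close> is a unit of the Laurent ring, this is a ring
  homomorphism only on \<^const>\<open>polys\<close>; a polynomial divisible by \<open>s3\<close> is in its kernel.
\<close>

definition at_s3_zero :: "int \<Rightarrow> int \<Rightarrow> laurent \<Rightarrow> int" where
  "at_s3_zero x y = laurent_subst x y 0 0"

lemma at_s3_zero_mult: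
  assumes "f \<in> polys" "g \<in> polys"
  shows "at_s3_zero x y (f * g) = at_s3_zero x y f * at_s3_zero x y g"
  unfolding at_s3_zero_def
  by (rule laurent_subst_mult_on[of "{(i, j, k). 0 \<le> k}"])
     (use assms in \<open>auto simp: polys_iff monom_subst_def power_add nat_add_distrib mult_ac\<close>)

lemma at_s3_zero_diff: "at_s3_zero x y (f - g) = at_s3_zero x y f - at_s3_zero x y g"
  by (simp add: at_s3_zero_def laurent_subst_diff)

lemma at_s3_zero_add: "at_s3_zero x y (f + g) = at_s3_zero x y f + at_s3_zero x y g"
  by (simp add: at_s3_zero_def laurent_subst_add)

lemma at_s3_zero_s: "at_s3_zero x y s1 = x" "at_s3_zero x y s2 = y" "at_s3_zero x y s3 = 0"
  by (simp_all add: at_s3_zero_def s1_def s2_def s3_def s3_pow_def laurent_subst_single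
      monom_subst_def)

text \<open>
  Two different values exclude a constant, and a nonzero value at \<open>s3 = 0\<close> excludes the factor
  \<open>s3\<close>.
\<close>

lemma reduced_polyI:
  assumes "f \<in> polys" "at_s3_zero x y f \<noteq> 0" "at_s3_zero 0 0 f = 0"
  shows "reduced_poly f"
  unfolding reduced_poly_def
proof (intro conjI notI)
  assume "\<exists>c::int. f = of_int c"
  with assms show False by (auto simp: at_s3_zero_def laurent_subst_of_int)
next
  assume "\<exists>g. g \<in> polys \<and> f = s3 * g"
  with assms show False by (auto simp: at_s3_zero_mult polys_s at_s3_zero_s)
qed (use assms in simp)

lemma polys_h: "h n \<in> polys"
  by (auto simp: h_def intro!: polys_intros)

lemma at_s3_zero_h:
  "at_s3_zero x y (h n) = (if odd n then y ^ 2 else x ^ 2 - y)"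
  by (simp add: h_def power2_eq_square at_s3_zero_diff at_s3_zero_mult at_s3_zero_s polys_intros)

lemma polys_star_pell: "star_pell n \<in> polys"
  by (induction n rule: star_pell.induct) (auto intro!: polys_intros polys_h)

text \<open>
  The term with \<open>s3\<^sup>2\<close> in the recursion disappears at \<open>s3 = 0\<close>, and the first two
  polynomials are related in the same way.
\<close>

lemma at_s3_zero_star_pell:
  "at_s3_zero x y (star_pell (Suc n)) = at_s3_zero x y (h n) * at_s3_zero x y (star_pell n)"
proof (cases n)
  case 0
  then show ?thesis
    by (simp add: at_s3_zero_h at_s3_zero_diff at_s3_zero_add at_s3_zero_mult at_s3_zero_s
        polys_intros power2_eq_square left_diff_distrib)
next
  case (Suc m)
  then show ?thesis
    by (simp add: at_s3_zero_diff at_s3_zero_mult at_s3_zero_s polys_intros polys_h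
        polys_star_pell power2_eq_square)
qed

lemma reduced_h: "reduced_poly (h n)"
  by (rule reduced_polyI[of _ 2 1]) (auto simp: polys_h at_s3_zero_h)

lemma reduced_star_pell: "reduced_poly (star_pell n)"
proof (rule reduced_polyI[of _ 2 1])
  show "at_s3_zero 2 1 (star_pell n) \<noteq> 0"
    by (induction n) (auto simp: at_s3_zero_star_pell at_s3_zero_h at_s3_zero_s
        simp del: star_pell.simps(2,3))
  show "at_s3_zero 0 0 (star_pell n) = 0"
    by (induction n) (auto simp: at_s3_zero_star_pell at_s3_zero_h at_s3_zero_s
        simp del: star_pell.simps(2,3))
qed (rule polys_star_pell)

text \<open>
  If \<open>k\<close> were positive, \<open>g\<close> would be divisible by \<open>s3\<close>; if it were negative, \<open>f\<close> would be.
\<close>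

lemma reduced_poly_s3_multiple:
  assumes "reduced_poly f" "reduced_poly g" "g = s3_pow k * f"
  shows "k = 0"
proof -
  have no_pos: "\<not> 0 < k"
    if "reduced_poly f" "reduced_poly g" "g = s3_pow k * f" for f g k
  proof
    assume "0 < k"
    then obtain n where k: "k = int (Suc n)"
      by (metis gr0_implies_Suc zero_less_imp_eq_int)
    have "g = s3 * (s3 ^ n * f)"
      using that(3) by (simp only: k s3_pow_nat power_Suc mult.assoc)
    moreover have "s3 ^ n * f \<in> polys"
      using that(1) by (simp add: reduced_poly_def polys_intros)
    ultimately show False
      using that(2) by (auto simp: reduced_poly_def)
  qed
  have "f = s3_pow (- k) * g"
    by (simp add: assms(3) flip: mult.assoc)
  then have "\<not> 0 < - k"
    using no_pos assms by blast
  with no_pos[OF assms] show ?thesis by simp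
qed

section \<open>The tree of positive solutions\<close>

text \<open>
  Only those Vieta moves that increase the evaluated middle coordinate are admitted, so that the
  evaluations stay at least 3 and the root is never reached again. Closure under the
  other Vieta moves is \<open>markov_tree_vieta\<close>.
\<close>

inductive_set markov_tree :: "triple set" where
  root: "initial_solution \<in> markov_tree"
| swap12: "(a, b, c) \<in> markov_tree \<Longrightarrow> (b, a, c) \<in> markov_tree"
| swap23: "(a, b, c) \<in> markov_tree \<Longrightarrow> (a, c, b) \<in> markov_tree"
| scale: "Y \<in> markov_tree \<Longrightarrow> mu_map i j Y \<in> markov_tree"
| grow: "(a, b, c) \<in> markov_tree \<Longrightarrow> 2 * ev b < ev a * ev c \<Longrightarrow>
    (star a, a * c - star b, star c) \<in> markov_tree"

lemma markov_tree_ge_3: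
  assumes "(a, b, c) \<in> markov_tree"
  shows "3 \<le> ev a" "3 \<le> ev b" "3 \<le> ev c"
proof -
  have "case Y of (a, b, c) \<Rightarrow> 3 \<le> ev a \<and> 3 \<le> ev b \<and> 3 \<le> ev c" if "Y \<in> markov_tree" for Y
    using that by induction (auto simp: initial_solution_def mu_map_def)
  with assms show "3 \<le> ev a" "3 \<le> ev b" "3 \<le> ev c" by auto
qed

text \<open>
  All three Vieta moves are treated at once, as the permutations interchange them. The root has
  only growing moves. After growth, the same move returns to the parent; with \<open>x\<close> the new middle
  value, \<open>x > ac / 2\<close> and \<open>a, c \<ge> 3\<close> give \<open>xc > 2a\<close> and \<open>ax > 2c\<close>, so the other two moves grow.
\<close>

lemma markov_tree_vieta:
  assumes "(a, b, c) \<in> markov_tree"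
  shows "(b * c - star a, star b, star c) \<in> markov_tree"
    and "(star a, a * c - star b, star c) \<in> markov_tree"
    and "(star a, star b, a * b - star c) \<in> markov_tree"
proof -
  have grow1: "(b * c - star a, star b, star c) \<in> markov_tree"
    if "(a, b, c) \<in> markov_tree" "2 * ev a < ev b * ev c" for a b c
    using that by (meson markov_tree.swap12 markov_tree.grow)
  have grow3: "(star a, star b, a * b - star c) \<in> markov_tree"
    if "(a, b, c) \<in> markov_tree" "2 * ev c < ev a * ev b" for a b c
    using that by (meson markov_tree.swap23 markov_tree.grow)
  have "case Y of (a, b, c) \<Rightarrow>
      (b * c - star a, star b, star c) \<in> markov_tree \<and>
      (star a, a * c - star b, star c) \<in> markov_tree \<and>
      (star a, star b, a * b - star c) \<in> markov_tree" if "Y \<in> markov_tree" for Y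
    using that
  proof induction
    case root
    have "(s1, s1 * s3_inv, s1) \<in> markov_tree"
      using markov_tree.root by (simp add: initial_solution_def)
    from grow1[OF this] markov_tree.grow[OF this] grow3[OF this] show ?case
      by (simp add: initial_solution_def)
  next
    case (swap12 a b c)
    then show ?case
      by (auto simp: mult.commute intro: markov_tree.swap12)
  next
    case (swap23 a b c)
    then show ?case
      by (auto simp: mult.commute intro: markov_tree.swap23)
  next
    case (scale Y i j)
    obtain a b c where Y: "Y = (a, b, c)" by (metis prod_cases3)
    have s: "s3_pow (- i - j) = s3_pow (- i) * s3_pow (- j)"
      "s3_pow (i + j) = s3_pow i * s3_pow j" "s3_pow (j + i) = s3_pow i * s3_pow j"
      using s3_pow_add[of "- i" "- j"] by (simp_all add: s3_pow_add)
    have cancel: "s3_pow i * (s3_pow (- i) * x) = x" "s3_pow j * (s3_pow (- j) * x) = x" for x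
      by (simp_all flip: mult.assoc)
    from scale.IH have
      "mu_map (- i) (- j) (b * c - star a, star b, star c) \<in> markov_tree"
      "mu_map (- i) (- j) (star a, a * c - star b, star c) \<in> markov_tree"
      "mu_map (- i) (- j) (star a, star b, a * b - star c) \<in> markov_tree"
      by (auto simp: Y intro: markov_tree.scale)
    then show ?case
      by (simp add: Y mu_map_def s algebra_simps cancel)
  next
    case (grow a b c)
    note child = markov_tree.grow[OF grow.hyps]
    have ge: "3 \<le> ev a" "3 \<le> ev b" "3 \<le> ev c"
      using markov_tree_ge_3 grow.hyps by auto
    have "3 * (ev a * ev c) \<le> ev a * ev c * ev c" "3 * (ev a * ev c) \<le> ev a * ev c * ev a"
      using ge by (simp_all add: mult.commute mult_left_mono)
    moreover have "3 * ev a \<le> ev a * ev c" "3 * ev c \<le> ev a * ev c"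
      using ge by (simp_all add: mult.commute mult_left_mono)
    moreover have "2 * ev b * ev c < ev a * ev c * ev c" "2 * ev b * ev a < ev a * ev c * ev a"
      using grow.hyps ge by (intro mult_strict_right_mono; simp)+
    ultimately have "2 * ev a < ev a * ev c * ev c - ev b * ev c"
      "2 * ev c < ev a * ev c * ev a - ev b * ev a"
      using ge by linarith+
    then have "2 * ev a < (ev a * ev c - ev b) * ev c" "2 * ev c < ev a * (ev a * ev c - ev b)"
      by (simp_all add: algebra_simps)
    then have "((a * c - star b) * star c - star (star a), star (a * c - star b), star (star c)) \<in> markov_tree"
      "(star (star a), star (a * c - star b), star a * (a * c - star b) - star (star c)) \<in> markov_tree"
      using grow1[OF child] grow3[OF child] by simp_all
    with grow.hyps show ?case by simp
  qed
  with assms show "(b * c - star a, star b, star c) \<in> markov_tree"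
    "(star a, a * c - star b, star c) \<in> markov_tree"
    "(star a, star b, a * b - star c) \<in> markov_tree" by auto
qed

lemma mu_map_mu_map: "mu_map i j (mu_map k l Y) = mu_map (i + k) (j + l) Y"
proof -
  have "s3_pow (- i - j) * s3_pow (- k - l) = s3_pow (- (i + k) - (j + l))"
    by (simp add: algebra_simps flip: s3_pow_add)
  then show ?thesis
    by (cases Y) (simp add: mu_map_def s3_pow_add flip: mult.assoc)
qed

lemma mu_map_0_0 [simp]: "mu_map 0 0 Y = Y"
  by (cases Y) (simp add: mu_map_def)

lemma mu_map_swap12: "mu_map i j (a, b, c) = (a', b', c') \<Longrightarrow> mu_map (- i - j) j (b, a, c) = (b', a', c')"
  by (auto simp: mu_map_def)

lemma mu_map_swap23: "mu_map i j (a, b, c) = (a', b', c') \<Longrightarrow> mu_map i (- i - j) (a, c, b) = (a', c', b')"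
  by (auto simp: mu_map_def)

lemma mu_map_vieta:
  assumes "mu_map i j (a, b, c) = (a', b', c')"
  shows "mu_map (- i) (- j) (star a, a * c - star b, star c) = (star a', a' * c' - star b', star c')"
proof -
  have "s3_pow (i + j) = s3_pow i * s3_pow j"
    by (simp add: s3_pow_add)
  with assms show ?thesis
    by (auto simp: mu_map_def algebra_simps)
qed

lemma Ev_mu_map [simp]: "Ev (mu_map i j Y) = Ev Y"
  by (cases Y) (simp add: Ev_def mu_map_def)

text \<open>
  A growing move makes the middle value exceed 3, so only permutations and rescalings
  remain over the root; and permuting the initial solution amounts to rescaling it.
\<close>

lemma markov_tree_fibre_root:
  assumes "Z \<in> markov_tree" "Ev Z = (3, 3, 3)"
  shows "\<exists>i j. Z = mu_map i j initial_solution"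
  using assms
proof induction
  case root
  then show ?case by (metis mu_map_0_0)
next
  case (swap12 a b c)
  then obtain i j where "mu_map i j (s1, s1 * s3_inv, s1) = (a, b, c)"
    by (auto simp: Ev_def initial_solution_def)
  from mu_map_swap12[OF this]
  have "(b, a, c) = mu_map (- i - j) j (mu_map (- 1) 0 initial_solution)"
    by (simp add: initial_solution_def mu_map_def s3_inv_def mult_ac flip: s3_pow_add)
  then show ?case by (metis mu_map_mu_map)
next
  case (swap23 a b c)
  then obtain i j where "mu_map i j (s1, s1 * s3_inv, s1) = (a, b, c)"
    by (auto simp: Ev_def initial_solution_def)
  from mu_map_swap23[OF this]
  have "(a, c, b) = mu_map i (- i - j) (mu_map 0 (- 1) initial_solution)"
    by (simp add: initial_solution_def mu_map_def s3_inv_def mult_ac flip: s3_pow_add)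
  then show ?case by (metis mu_map_mu_map)
next
  case (scale Y k l)
  then obtain i j where "Y = mu_map i j initial_solution" by auto
  then show ?case by (auto simp: mu_map_mu_map)
next
  case (grow a b c)
  then show ?case
    using markov_tree_ge_3[of a b c] by (simp add: Ev_def)
qed

text \<open>
  Induction on \<open>Y\<close>: undo the last step on \<open>Z\<close> as well. For a growing step this means to apply
  the Vieta move to \<open>Z\<close>, which stays in the tree by \<open>markov_tree_vieta\<close>, and to use that the
  move, an involution, intertwines rescalings.
\<close>

lemma markov_tree_fibre:
  assumes "Y \<in> markov_tree" "Z \<in> markov_tree" "Ev Z = Ev Y"
  shows "\<exists>i j. Z = mu_map i j Y"
  using assms
proof (induction arbitrary: Z)
  case root
  then show ?case
    using markov_tree_fibre_root by (simp add: Ev_def initial_solution_def)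
next
  case (swap12 a b c)
  obtain a' b' c' where Z: "Z = (a', b', c')" by (metis prod_cases3)
  have "(b', a', c') \<in> markov_tree" "Ev (b', a', c') = Ev (a, b, c)"
    using swap12.prems by (auto simp: Z Ev_def intro: markov_tree.swap12)
  from swap12.IH[OF this] obtain i j where "mu_map i j (a, b, c) = (b', a', c')" by metis
  from mu_map_swap12[OF this] show ?case unfolding Z by metis
next
  case (swap23 a b c)
  obtain a' b' c' where Z: "Z = (a', b', c')" by (metis prod_cases3)
  have "(a', c', b') \<in> markov_tree" "Ev (a', c', b') = Ev (a, b, c)"
    using swap23.prems by (auto simp: Z Ev_def intro: markov_tree.swap23)
  from swap23.IH[OF this] obtain i j where "mu_map i j (a, b, c) = (a', c', b')" by metis
  from mu_map_swap23[OF this] show ?case unfolding Z by metis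
next
  case (scale Y k l)
  then obtain i j where "Z = mu_map i j Y" by (metis Ev_mu_map)
  then have "Z = mu_map (i - k) (j - l) (mu_map k l Y)"
    by (simp add: mu_map_mu_map)
  then show ?case by blast
next
  case (grow a b c)
  obtain a' b' c' where Z: "Z = (a', b', c')" by (metis prod_cases3)
  have "(star a', a' * c' - star b', star c') \<in> markov_tree"
    using grow.prems markov_tree_vieta(2) by (simp add: Z)
  moreover have "Ev (star a', a' * c' - star b', star c') = Ev (a, b, c)"
    using grow.prems by (simp add: Z Ev_def)
  ultimately obtain i j
    where "mu_map i j (a, b, c) = (star a', a' * c' - star b', star c')"
    using grow.IH by metis
  from mu_map_vieta[OF this]
  have "mu_map (- i) (- j) (star a, a * c - star b, star c) = Z"
    by (simp add: Z algebra_simps)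
  then show ?case by metis
qed

section \<open>The orbit of the initial solution\<close>

definition vieta :: "triple \<Rightarrow> triple" where
  "vieta = (\<lambda>(a, b, c). (star a, a * c - star b, star c))"

lemma tau1_eq: "tau1 = lambda_map 1 1 \<circ> sigma2 \<circ> vieta"
  by (auto simp: tau1_def lambda_map_def sigma2_def vieta_def)

lemma tau2_eq: "tau2 = lambda_map 0 1 \<circ> vieta \<circ> sigma1"
  by (auto simp: tau2_def lambda_map_def sigma1_def vieta_def mult.commute)

text \<open>
  The given generators \<open>tau1\<close> and \<open>tau2\<close> are not involutions. They are replaced by the
  single involution \<^const>\<open>vieta\<close>, so that the inverse of each move is again a move.
\<close>

inductive_set basic_moves :: "(triple \<Rightarrow> triple) set" where
  lambda_map: "lambda_map i j \<in> basic_moves"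
| sigma1: "sigma1 \<in> basic_moves"
| sigma2: "sigma2 \<in> basic_moves"
| vieta: "vieta \<in> basic_moves"
| mu_map: "mu_map k l \<in> basic_moves"

lemma basic_moves_inverse:
  assumes "g \<in> basic_moves"
  obtains g' where "g' \<in> basic_moves" "g' \<circ> g = id" "g \<circ> g' = id"
proof -
  have lambda: "lambda_map i j \<circ> lambda_map i j = id" for i j
    by (auto simp: lambda_map_def fun_eq_iff simp flip: mult.assoc)
  have swaps: "sigma1 \<circ> sigma1 = id" "sigma2 \<circ> sigma2 = id" "vieta \<circ> vieta = id"
    by (auto simp: sigma1_def sigma2_def vieta_def)
  have mu: "mu_map (- k) (- l) \<circ> mu_map k l = id" "mu_map k l \<circ> mu_map (- k) (- l) = id" for k l
    by (simp_all add: fun_eq_iff mu_map_mu_map del: split_paired_All)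
  show thesis
    using assms
  proof cases
    case (mu_map k l)
    then show thesis
      using that[of "mu_map (- k) (- l)"] mu by (simp add: basic_moves.mu_map)
  qed (use that lambda swaps basic_moves.intros in metis)+
qed

text \<open>
  A uniform length of three covers \<open>tau1\<close> and \<open>tau2\<close>; shorter products are padded with the
  identity \<open>mu_map 0 0\<close>.
\<close>

lemma generator_as_basic_moves:
  assumes "g \<in> star_markov_generators"
  obtains u v w where "u \<in> basic_moves" "v \<in> basic_moves" "w \<in> basic_moves" "g = u \<circ> v \<circ> w"
proof -
  have "g \<in> basic_moves \<or> g = tau1 \<or> g = tau2"
    using assms by (auto simp: star_markov_generators_def intro: basic_moves.intros)
  moreover have "mu_map 0 0 = id"
    by (simp add: fun_eq_iff del: split_paired_All)
  ultimately show thesis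
    using that tau1_eq tau2_eq by (metis basic_moves.intros comp_id)
qed

definition signed_tree :: "triple set" where
  "signed_tree = (\<Union>i j. lambda_map i j ` markov_tree)"

lemma signed_treeI: "Y \<in> markov_tree \<Longrightarrow> lambda_map i j Y \<in> signed_tree"
  by (auto simp: signed_tree_def)

text \<open>
  Signs commute with every move up to relabelling, so the claim is the closure of
  \<^const>\<open>markov_tree\<close>.
\<close>

lemma signed_tree_closed:
  assumes "g \<in> basic_moves" "Y \<in> signed_tree"
  shows "g Y \<in> signed_tree"
proof -
  obtain i j a b c where Y: "Y = lambda_map i j (a, b, c)" and T: "(a, b, c) \<in> markov_tree"
    using assms(2) by (auto simp: signed_tree_def)
  have lambda: "lambda_map k l Y = lambda_map (k + i) (l + j) (a, b, c)" for k l
    by (simp add: Y lambda_map_def power_add mult_ac)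
  have sigma1: "sigma1 Y = lambda_map (i + j) j (b, a, c)"
    by (simp add: Y lambda_map_def sigma1_def power_add mult_ac)
  have sigma2: "sigma2 Y = lambda_map i (i + j) (a, c, b)"
    by (simp add: Y lambda_map_def sigma2_def power_add flip: mult.assoc)
  have vieta: "vieta Y = lambda_map i j (star a, a * c - star b, star c)"
    by (simp add: Y lambda_map_def vieta_def power_add algebra_simps)
  have mu: "mu_map k l Y = lambda_map i j (mu_map k l (a, b, c))" for k l
    by (simp add: Y lambda_map_def mu_map_def mult_ac)
  show ?thesis
    using assms(1)
    by cases (simp_all add: lambda sigma1 sigma2 vieta mu signed_treeI T markov_tree.swap12[OF T]
        markov_tree.swap23[OF T] markov_tree.scale[OF T] markov_tree_vieta(2)[OF T])
qed

lemma generator_bij: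
  assumes "g \<in> star_markov_generators"
  shows "bij g"
proof -
  have "bij u" if "u \<in> basic_moves" for u
    using basic_moves_inverse[OF that] by (metis o_bij)
  with generator_as_basic_moves[OF assms] show ?thesis
    by (metis bij_comp)
qed

lemma generators_in_carrier: "star_markov_generators \<subseteq> carrier (BijGroup UNIV)"
  by (auto simp: BijGroup_def Bij_def generator_bij)

lemma group_mult_eq_comp:
  assumes "f \<in> carrier (BijGroup UNIV)" "g \<in> carrier (BijGroup UNIV)"
  shows "f \<otimes>\<^bsub>BijGroup UNIV\<^esub> g = f \<circ> g"
  using assms by (auto simp: BijGroup_def compose_def)

lemma signed_tree_generator:
  assumes "g \<in> star_markov_generators" "Y \<in> signed_tree"
  shows "g Y \<in> signed_tree" "inv_into UNIV g Y \<in> signed_tree"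
proof -
  obtain u v w where uvw: "u \<in> basic_moves" "v \<in> basic_moves" "w \<in> basic_moves" "g = u \<circ> v \<circ> w"
    using generator_as_basic_moves[OF assms(1)] .
  then show "g Y \<in> signed_tree"
    using assms(2) by (simp add: signed_tree_closed)
  obtain u' where u': "u' \<in> basic_moves" "u \<circ> u' = id" using basic_moves_inverse[OF uvw(1)] .
  obtain v' where v': "v' \<in> basic_moves" "v \<circ> v' = id" using basic_moves_inverse[OF uvw(2)] .
  obtain w' where w': "w' \<in> basic_moves" "w \<circ> w' = id" using basic_moves_inverse[OF uvw(3)] .
  have "g (w' (v' (u' Y))) = Y"
    using u'(2) v'(2) w'(2) by (simp add: uvw(4) fun_eq_iff del: split_paired_All)
  then have "inv_into UNIV g Y = w' (v' (u' Y))"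
    using generator_bij[OF assms(1)] by (metis bij_inv_eq_iff)
  then show "inv_into UNIV g Y \<in> signed_tree"
    using u'(1) v'(1) w'(1) assms(2) by (simp add: signed_tree_closed)
qed

lemma orbit_subset_signed_tree: "star_markov_orbit \<subseteq> signed_tree"
proof -
  have "g Y \<in> signed_tree" if "g \<in> star_markov_group" "Y \<in> signed_tree" for g Y
    using that unfolding star_markov_group_def
  proof (induction arbitrary: Y)
    case one
    then show ?case by (simp add: BijGroup_def)
  next
    case (incl g)
    then show ?case by (simp add: signed_tree_generator)
  next
    case (inv g)
    have "g \<in> Bij UNIV"
      using generators_in_carrier inv.hyps by (auto simp: BijGroup_def)
    then show ?case
      using inv by (simp add: inv_BijGroup signed_tree_generator)
  next
    case (eng g1 g2)
    then show ?case
      using group.generate_in_carrier[OF group_BijGroup generators_in_carrier]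
      by (simp add: group_mult_eq_comp)
  qed
  moreover have "initial_solution \<in> signed_tree"
    using signed_treeI[OF markov_tree.root, of 0 0]
    by (simp add: lambda_map_def initial_solution_def)
  ultimately show ?thesis
    unfolding star_markov_orbit_def by blast
qed

lemma markov_tree_of_positive:
  assumes "(x, y, z) \<in> signed_tree" "0 < ev x" "0 < ev y" "0 < ev z"
  shows "(x, y, z) \<in> markov_tree"
proof -
  obtain i j a b c where T: "(a, b, c) \<in> markov_tree"
    and eq: "x = (- 1) ^ i * a" "y = (- 1) ^ (i + j) * b" "z = (- 1) ^ j * c"
    using assms(1) by (auto simp: signed_tree_def lambda_map_def)
  have "0 < ev a" "0 < ev c"
    using markov_tree_ge_3[OF T] by auto
  with assms(2,4) eq have "even i" "even j"
    by (cases "even i"; cases "even j"; simp)+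
  with T eq show ?thesis by simp
qed

lemma initial_in_orbit: "initial_solution \<in> star_markov_orbit"
proof -
  have "\<one>\<^bsub>BijGroup UNIV\<^esub> \<in> star_markov_group"
    unfolding star_markov_group_def by (rule generate.one)
  moreover have "initial_solution = \<one>\<^bsub>BijGroup UNIV\<^esub> initial_solution"
    by (simp add: BijGroup_def)
  ultimately show ?thesis
    unfolding star_markov_orbit_def by blast
qed

lemma orbit_closed:
  assumes "g \<in> star_markov_generators" "Y \<in> star_markov_orbit"
  shows "g Y \<in> star_markov_orbit"
proof -
  obtain f where f: "f \<in> star_markov_group" "Y = f initial_solution"
    using assms(2) by (auto simp: star_markov_orbit_def)
  have "g \<otimes>\<^bsub>BijGroup UNIV\<^esub> f = g \<circ> f"
    using f(1) assms(1) generators_in_carrier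
      group.generate_in_carrier[OF group_BijGroup generators_in_carrier]
    by (intro group_mult_eq_comp) (auto simp: star_markov_group_def)
  moreover have "g \<otimes>\<^bsub>BijGroup UNIV\<^esub> f \<in> star_markov_group"
    using f(1) assms(1) by (simp add: star_markov_group_def generate.incl generate.eng)
  ultimately have "g \<circ> f \<in> star_markov_group" by simp
  moreover have "g Y = (g \<circ> f) initial_solution"
    by (simp add: f(2))
  ultimately show ?thesis
    unfolding star_markov_orbit_def by blast
qed

definition markov_form :: "triple \<Rightarrow> laurent" where
  "markov_form = (\<lambda>(a, b, c). a * star a + b * star b + c * star c - a * b * c)"

lemma star_markov_solution_iff:
  "star_markov_solution Y \<longleftrightarrow> markov_form Y = (3 * s1 * s2 - s1 ^ 3) * s3_inv"
  by (cases Y) (simp add: star_markov_solution_def markov_form_def)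

text \<open>
  For the Vieta move this is the usual root exchange: with \<open>x = ac - b*\<close> one has
  \<open>x x* - a* x c* = (ac - b*)(-b) = b b* - abc\<close>.
\<close>

lemma markov_form_basic_move:
  assumes "g \<in> basic_moves"
  shows "markov_form (g Y) = markov_form Y"
proof -
  obtain a b c where Y: "Y = (a, b, c)" by (metis prod_cases3)
  have "markov_form (lambda_map i j Y) = markov_form Y" for i j
    by (cases "even i"; cases "even j") (simp_all add: Y markov_form_def lambda_map_def)
  moreover have "markov_form (sigma1 Y) = markov_form Y" "markov_form (sigma2 Y) = markov_form Y"
    "markov_form (vieta Y) = markov_form Y"
    by (simp_all add: Y markov_form_def sigma1_def sigma2_def vieta_def algebra_simps)
  moreover have "markov_form (mu_map i j Y) = markov_form Y" for i j
  proof -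
    have unit: "s3_pow (- i - j) * s3_pow (i + j) = 1"
      "s3_pow i * s3_pow (- i - j) * s3_pow j = 1"
      by (simp_all flip: s3_pow_add)
    have "s3_pow i * a * star (s3_pow i * a) = (s3_pow i * s3_pow (- i)) * (a * star a)"
      "s3_pow (- i - j) * b * star (s3_pow (- i - j) * b) =
        (s3_pow (- i - j) * s3_pow (i + j)) * (b * star b)"
      "s3_pow j * c * star (s3_pow j * c) = (s3_pow j * s3_pow (- j)) * (c * star c)"
      "s3_pow i * a * (s3_pow (- i - j) * b) * (s3_pow j * c) =
        (s3_pow i * s3_pow (- i - j) * s3_pow j) * (a * b * c)"
      by (simp_all add: ac_simps)
    then show ?thesis
      by (simp only: Y markov_form_def mu_map_def case_prod_conv unit s3_pow_cancel mult_1_left)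
  qed
  ultimately show ?thesis
    using assms by (auto elim: basic_moves.cases)
qed

definition solution_orbit :: "triple set" where
  "solution_orbit = {Y \<in> star_markov_orbit. star_markov_solution Y}"

lemma solution_orbit_closed:
  assumes "Y \<in> solution_orbit"
  shows "tau1 Y \<in> solution_orbit" "tau2 Y \<in> solution_orbit" "mu_map k l Y \<in> solution_orbit"
    and "i \<in> {0, 1} \<Longrightarrow> j \<in> {0, 1} \<Longrightarrow> lambda_map i j Y \<in> solution_orbit"
proof -
  have closed: "g Y \<in> solution_orbit" if g: "g \<in> star_markov_generators" for g
  proof -
    obtain u v w where "u \<in> basic_moves" "v \<in> basic_moves" "w \<in> basic_moves" "g = u \<circ> v \<circ> w"
      using generator_as_basic_moves[OF g] .
    then have "markov_form (g Y) = markov_form Y"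
      by (simp add: markov_form_basic_move)
    with assms orbit_closed[OF g] show ?thesis
      by (simp add: solution_orbit_def star_markov_solution_iff)
  qed
  show "tau1 Y \<in> solution_orbit" "tau2 Y \<in> solution_orbit" "mu_map k l Y \<in> solution_orbit"
    by (rule closed, auto simp: star_markov_generators_def)+
  show "lambda_map i j Y \<in> solution_orbit" if "i \<in> {0, 1}" "j \<in> {0, 1}"
    by (rule closed) (use that in \<open>auto simp: star_markov_generators_def\<close>)
qed

lemma initial_in_solution_orbit: "initial_solution \<in> solution_orbit"
proof -
  have "star_markov_solution initial_solution"
    by (simp add: star_markov_solution_iff markov_form_def initial_solution_def algebra_simps
        power3_eq_cube s3_cancel)
  with initial_in_orbit show ?thesis by (simp add: solution_orbit_def)
qed

section \<open>The Pell triples\<close>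

definition pell_triple :: "nat \<Rightarrow> triple" where
  "pell_triple n = (star (star_pell n), star_pell (Suc n), star (h n))"

lemma s3_pow_2: "s3_pow 2 = s3\<^sup>2" "s3_pow (- 2) = s3_inv\<^sup>2"
  using s3_pow_nat[of 2] s3_inv_pow_nat[of 2] by simp_all

lemma h_Suc: "h (Suc n) = s3\<^sup>2 * star (h n)"
  by (simp add: h_def power2_eq_square algebra_simps s3_cancel)

text \<open>
  The recursion of \<^const>\<open>star_pell\<close> is this Vieta move: since \<open>h (n + 1)\<close> equals
  \<open>s3\<^sup>2 * star (h n)\<close>, the new middle entry is
  \<open>s3\<^sup>2 * (star (h n) * g - f)\<close>.
\<close>

lemma pell_step:
  "lambda_map 0 1 (mu_map 0 (- 2) (tau2 (star f, g, star (h n)))) =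
     (star g, h (Suc n) * g - s3\<^sup>2 * f, star (h (Suc n)))"
  by (simp add: lambda_map_def mu_map_def tau2_def h_Suc s3_pow_2 algebra_simps)

text \<open>
  The recursion extended backwards gives \<open>s1 / s3\<close> in place of the polynomial before
  \<open>star_pell 0\<close>, and \<open>h\<close> is 2-periodic, so index 1 serves for the index before 0. The resulting
  triple \<open>(star (s1 / s3), s2, star (h 1))\<close> is a neighbour of the initial solution.
\<close>

lemma pell_triple_0:
  "pell_triple 0 =
     lambda_map 0 1 (mu_map 0 (- 2) (tau2 (lambda_map 1 1 (mu_map 1 (- 2) (tau1 initial_solution)))))"
proof -
  have s3: "s3_pow 1 = s3" by (simp add: s3_def)
  have "lambda_map 1 1 (mu_map 1 (- 2) (tau1 initial_solution)) = (star (s1 * s3_inv), s2, star (h 1))"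
    by (simp add: lambda_map_def mu_map_def tau1_def initial_solution_def s3_pow_2 s3 s3_cancel
        h_def power2_eq_square algebra_simps)
  moreover have "h 2 * s2 - s3\<^sup>2 * (s1 * s3_inv) = star_pell 1" "h 2 = h 0"
    by (simp_all add: h_def power2_eq_square algebra_simps s3_cancel)
  ultimately show ?thesis
    using pell_step[of "s1 * s3_inv" s2 1] by (simp add: pell_triple_def numeral_2_eq_2)
qed

lemma pell_triple_in_solution_orbit: "pell_triple n \<in> solution_orbit"
proof (induction n)
  case 0
  show ?case
    unfolding pell_triple_0 by (intro solution_orbit_closed initial_in_solution_orbit) auto
next
  case (Suc n)
  have "pell_triple (Suc n) = lambda_map 0 1 (mu_map 0 (- 2) (tau2 (pell_triple n)))"
    unfolding pell_triple_def by (simp add: pell_step del: star_pell.simps(2) One_nat_def)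
  with Suc show ?case
    by (auto intro!: solution_orbit_closed)
qed

lemma ev_star_pell: "ev (star_pell n) = 3 * odd_pell n"
  by (induction n rule: star_pell.induct) (auto simp: h_def)

lemma odd_pell_increasing: "0 < odd_pell n \<and> 5 * odd_pell n \<le> odd_pell (Suc n)"
  by (induction n) auto

text \<open>
  This is the Markov equation divided by 9; the quadratic form is invariant under the recursion.
\<close>

lemma odd_pell_conic:
  "(odd_pell n)\<^sup>2 + (odd_pell (Suc n))\<^sup>2 + 4 = 6 * odd_pell n * odd_pell (Suc n)"
  by (induction n) (auto simp: power2_eq_square algebra_simps)

lemma pell_markov_triple: "markov_triple (3 * odd_pell n, 3 * odd_pell (Suc n), 6)"
  using odd_pell_conic[of n] odd_pell_increasing[of n]
  by (auto simp: markov_triple_def power2_eq_square algebra_simps)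

theorem theorem9p2:
  fixes n :: nat
  assumes "n > 0"
  shows "reduced_polynomial_presentation
           (star (star_pell (n - 1)), star_pell n, star (h (n - 1)))
           (3 * odd_pell (n - 1), 3 * odd_pell n, 6)"
proof -
  obtain m where n: "n = Suc m" using assms gr0_implies_Suc by blast
  let ?t = "(3 * odd_pell m, 3 * odd_pell (Suc m), 6)"
  let ?S = "{Y \<in> star_markov_orbit. reduced_polynomial_solution Y \<and> Ev Y = ?t}"
  have Ev: "Ev (pell_triple m) = ?t"
    by (simp add: Ev_def pell_triple_def ev_star_pell h_def del: star_pell.simps odd_pell.simps)
  have positive: "0 < odd_pell m" "0 < odd_pell (Suc m)"
    using odd_pell_increasing by auto
  have tree: "Y \<in> markov_tree" if "Y \<in> star_markov_orbit" "Ev Y = ?t" for Y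
    using that orbit_subset_signed_tree positive
    by (cases Y) (auto simp: Ev_def intro!: markov_tree_of_positive)
  have "reduced_polynomial_solution (pell_triple m)"
    using pell_triple_in_solution_orbit[of m] reduced_star_pell reduced_h
    unfolding solution_orbit_def reduced_polynomial_solution_def pell_triple_def by blast
  with Ev have "pell_triple m \<in> ?S"
    using pell_triple_in_solution_orbit[of m] by (simp add: solution_orbit_def)
  moreover have "Y = pell_triple m" if Y: "Y \<in> ?S" for Y
  proof -
    have "Y \<in> markov_tree" "pell_triple m \<in> markov_tree"
      using tree Y pell_triple_in_solution_orbit[of m] Ev by (auto simp: solution_orbit_def)
    moreover have "Ev Y = Ev (pell_triple m)"
      using Y Ev by simp
    ultimately obtain i j where mu: "Y = mu_map i j (pell_triple m)"
      using markov_tree_fibre by blast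
    obtain f1 f2 f3 where f: "Y = (star f1, f2, star f3)"
      and red: "reduced_poly f1" "reduced_poly f3"
      using Y unfolding reduced_polynomial_solution_def by blast
    have "star f1 = star (s3_pow (- i) * star_pell m)" "star f3 = star (s3_pow (- j) * h m)"
      using mu by (simp_all add: f mu_map_def pell_triple_def)
    then have "f1 = s3_pow (- i) * star_pell m" "f3 = s3_pow (- j) * h m"
      by (simp_all only: star_eq_iff)
    then have "- i = 0" "- j = 0"
      using reduced_poly_s3_multiple red reduced_star_pell reduced_h by blast+
    with mu show ?thesis by simp
  qed
  ultimately have "?S = {pell_triple m}" by blast
  moreover have "3 * odd_pell m < 3 * odd_pell (Suc m)" "6 < 3 * odd_pell (Suc m)"
    using odd_pell_increasing[of m] by auto
  ultimately show ?thesis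
    using pell_markov_triple[of m] positive
    by (simp add: n reduced_polynomial_presentation_def pell_triple_def
        del: star_pell.simps odd_pell.simps)
qed

end
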